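(* There are constants $\epsilon,\gamma>0$ such that for all $n$ and all $k\le\epsilon n$: every classical (randomized) communication protocol with communication at most $\epsilon n$ in which Alice holds $x^{(1)},\dots,x^{(k)}\in\{0,1\}^n$, Bob holds $y^{(1)},\dots,y^{(k)}\in\{0,1\}^n$, and which outputs claimed values of $DISJ(x^{(1)},y^{(1)}),\dots,DISJ(x^{(k)},y^{(k)})$, has, on some input, probability at most $2^{-\gamma k}$ that all $k$ outputs are simultaneously correct.
   Context: $DISJ:\{0,1\}^n\times\{0,1\}^n\to\{0,1\}$, $DISJ(x,y)=1$ iff there is no $i$ with $x_i=y_i=1$ (the sets represented by $x$ and $y$ are disjoint). *)

theory Defs
  imports "HOL-Probability.Probability_Mass_Function"
begin

definition DISJ :: "bool list \<Rightarrow> bool list \<Rightarrow> bool" where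
  "DISJ x y = (\<not> (\<exists>i < min (length x) (length y). x ! i \<and> y ! i))"

datatype ('x, 'y, 'o) protocol =
    Leaf 'o
  | AliceSends "'x \<Rightarrow> bool" "('x, 'y, 'o) protocol" "('x, 'y, 'o) protocol"
  | BobSends "'y \<Rightarrow> bool" "('x, 'y, 'o) protocol" "('x, 'y, 'o) protocol"

fun run :: "('x, 'y, 'o) protocol \<Rightarrow> 'x \<Rightarrow> 'y \<Rightarrow> 'o" where
  "run (Leaf v) x y = v"
| "run (AliceSends f p0 p1) x y = (if f x then run p1 x y else run p0 x y)"
| "run (BobSends g p0 p1) x y = (if g y then run p1 x y else run p0 x y)"

fun cost :: "('x, 'y, 'o) protocol \<Rightarrow> nat" where
  "cost (Leaf v) = 0"
| "cost (AliceSends f p0 p1) = Suc (max (cost p0) (cost p1))"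
| "cost (BobSends g p0 p1) = Suc (max (cost p0) (cost p1))"

text \<open>A (public-coin) randomized protocol is a probability distribution over
  deterministic protocols; its communication is the maximum cost in its support.\<close>
definition rand_cost_le :: "('x, 'y, 'o) protocol pmf \<Rightarrow> real \<Rightarrow> bool" where
  "rand_cost_le P c = (\<forall>p \<in> set_pmf P. real (cost p) \<le> c)"

definition success_prob :: "('x, 'y, 'o) protocol pmf \<Rightarrow> 'x \<Rightarrow> 'y \<Rightarrow> 'o \<Rightarrow> real" where
  "success_prob P x y v = measure_pmf.prob P {p. run p x y = v}"

end

theory Submission
  imports Defs
begin

text \<open>
  Following Razborov, let \<open>U\<close> have \<open>2 m + 1\<close> elements and split it at random into a point \<open>i\<close> and two
  sets of size \<open>m\<close>. Alice gets a random subset of one part and Bob of the other; in an intersecting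
  instance \<open>i\<close> is added to both. Seen from either player, \<open>i\<close> is a uniformly random point of the \<open>m + 1\<close>
  elements from which that player's set is drawn, and a family of subsets that is not exponentially
  small has almost no coordinate that is far from balanced. Hence every rectangle that is not
  exponentially small contains a constant fraction of intersecting instances.

  Given \<open>k\<close> independent instances, this applies one coordinate at a time: conditioned on a rectangle, a
  claimed answer with \<open>j\<close> entries \<open>disjoint\<close> is right with probability at most \<open>\<alpha>\<close> to the power \<open>j\<close>, up to
  an error exponentially small in \<open>n\<close>. The error survives the union bound over the leaves of a
  protocol of communication \<open>\<epsilon> n\<close>. A correct answer has about \<open>k / 2\<close> such entries; the deviations
  are absorbed by taking a geometric mean.
\<close>

section \<open>Biased coordinates of set families\<close>

text \<open>Points of \<open>W\<close> choose membership independently, so the sum factors: a point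
  of \<open>I\<close> contributes 3 + 1, any other point 1 + 1.\<close>

lemma sum_Pow_power_card:
  fixes s :: "'a \<Rightarrow> bool"
  assumes "finite W" "I \<subseteq> W"
  shows "(\<Sum>X\<in>Pow W. (3::real) ^ card {i\<in>I. (i \<in> X) = s i}) = 2 ^ card W * 2 ^ card I"
proof -
  define f g :: "'a \<Rightarrow> real" where "f = (\<lambda>i. if i \<in> I \<and> s i then 3 else 1)"
    and "g = (\<lambda>i. if i \<in> I \<and> \<not> s i then 3 else 1)"
  have "3 ^ card {i\<in>I. (i \<in> X) = s i} = prod f X * prod g (W - X)" if "X \<subseteq> W" for X
  proof -
    have fin: "finite X" "finite (W - X)" using assms that finite_subset by auto
    have "{i\<in>I. (i \<in> X) = s i} = {i\<in>X. i \<in> I \<and> s i} \<union> {i\<in>W - X. i \<in> I \<and> \<not> s i}"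
      using assms that by auto
    then have "card {i\<in>I. (i \<in> X) = s i}
        = card {i\<in>X. i \<in> I \<and> s i} + card {i\<in>W - X. i \<in> I \<and> \<not> s i}"
      using fin by (simp add: card_Un_disjnt disjnt_def disjoint_iff)
    moreover have "prod f X = 3 ^ card {i\<in>X. i \<in> I \<and> s i}"
      unfolding f_def using fin by (simp add: prod.If_cases Int_def)
    moreover have "prod g (W - X) = 3 ^ card {i\<in>W - X. i \<in> I \<and> \<not> s i}"
      unfolding g_def using fin by (subst prod.If_cases) (auto simp: Int_def)
    ultimately show ?thesis by (simp add: power_add)
  qed
  then have "(\<Sum>X\<in>Pow W. (3::real) ^ card {i\<in>I. (i \<in> X) = s i})
      = (\<Sum>X\<in>Pow W. prod f X * prod g (W - X))" by simp
  also have "\<dots> = (\<Prod>i\<in>W. f i + g i)" using assms(1) by (simp add: prod_add)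
  also have "\<dots> = (\<Prod>i\<in>W. 2 * (if i \<in> I then 2 else 1))"
    by (intro prod.cong) (auto simp: f_def g_def)
  also have "\<dots> = 2 ^ card W * 2 ^ card I"
    using assms by (simp add: prod.distrib prod.If_cases Int_absorb1)
  finally show ?thesis .
qed

text \<open>On average a set of \<A> agrees with \<open>s\<close> on at least 3/4 of
  \<open>I\<close>, a uniform subset of \<open>W\<close> on only half; this forces exponentially
  small density. The weight 3 is the odds 3/4 : 1/4, which optimise the bound, and 16/27 is (2 / 3
  powr (3/4)) ^ 4.\<close>

lemma card_family_le_if_biased:
  assumes "finite W" "\<A> \<subseteq> Pow W" "I \<subseteq> W"
    and biased: "\<And>i. i \<in> I \<Longrightarrow> 3 * card \<A> \<le> 4 * card {X\<in>\<A>. (i \<in> X) = s i}"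
  shows "real (card \<A>) \<le> 2 ^ card W * (16/27) powr (card I / 4)"
proof -
  have fin: "finite I" "finite \<A>" using assms finite_subset by (blast, meson finite_Pow_iff finite_subset)
  define N where "N X = card {i\<in>I. (i \<in> X) = s i}" for X
  \<comment> \<open>An exponential moment bound: compare the average of \<open>3 ^ N X\<close> over \<open>\<A>\<close> and over all subsets of \<open>W\<close>.\<close>
  define t :: real where "t = 3 powr (3 * card I / 4)"
  have tpos: "t > 0" by (simp add: t_def)
  have "(\<Sum>X\<in>\<A>. N X) = (\<Sum>X\<in>\<A>. \<Sum>i\<in>I. if (i \<in> X) = s i then 1 else 0)"
    unfolding N_def using fin by (simp add: sum.If_cases Int_def)
  also have "\<dots> = (\<Sum>i\<in>I. card {X\<in>\<A>. (i \<in> X) = s i})"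
    using fin by (subst sum.swap) (simp add: sum.If_cases Int_def)
  finally have swap: "(\<Sum>X\<in>\<A>. N X) = (\<Sum>i\<in>I. card {X\<in>\<A>. (i \<in> X) = s i})" .
  have "card I * (3 * card \<A>) \<le> (\<Sum>i\<in>I. 4 * card {X\<in>\<A>. (i \<in> X) = s i})"
    using biased by (intro sum_bounded_below[where K = "3 * card \<A>", simplified of_nat_id]) auto
  also have "\<dots> = 4 * (\<Sum>X\<in>\<A>. N X)"
    by (simp add: swap sum_distrib_left)
  finally have "real (card I * (3 * card \<A>)) \<le> real (4 * (\<Sum>X\<in>\<A>. N X))"
    by (rule of_nat_mono)
  then have avg: "real (card \<A>) * (3 * card I / 4) \<le> (\<Sum>X\<in>\<A>. real (N X))"
    by (simp add: field_simps)
  \<comment> \<open>A power of 3 lies above its tangent at 3/4 of \<open>card I\<close>, so only the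
    mean of \<open>N\<close> enters, as in Jensen's inequality.\<close>
  have "t * (1 + (real (N X) - 3 * card I / 4) * ln 3) \<le> 3 ^ N X" for X
  proof -
    have "1 + (real (N X) - 3 * card I / 4) * ln 3 \<le> 3 powr (real (N X) - 3 * card I / 4)"
      using exp_ge_add_one_self[of "(real (N X) - 3 * card I / 4) * ln 3"] by (simp add: powr_def)
    also have "\<dots> = 3 ^ N X / t"
      by (simp add: t_def powr_diff powr_realpow)
    finally show ?thesis using tpos by (simp add: field_simps)
  qed
  then have "(\<Sum>X\<in>\<A>. t * (1 + (real (N X) - 3 * card I / 4) * ln 3)) \<le> (\<Sum>X\<in>\<A>. 3 ^ N X)"
    by (intro sum_mono)
  also have "\<dots> \<le> (\<Sum>X\<in>Pow W. 3 ^ N X)"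
    using assms by (intro sum_mono2) auto
  also have "\<dots> = 2 ^ card W * 2 ^ card I"
    unfolding N_def by (rule sum_Pow_power_card) fact+
  finally have le: "t * (\<Sum>X\<in>\<A>. 1 + (real (N X) - 3 * card I / 4) * ln 3) \<le> 2 ^ card W * 2 ^ card I"
    by (simp add: sum_distrib_left)
  have "(\<Sum>X\<in>\<A>. 1 + (real (N X) - 3 * card I / 4) * ln 3)
      = card \<A> + ((\<Sum>X\<in>\<A>. real (N X)) - real (card \<A>) * (3 * card I / 4)) * ln 3"
    by (simp add: sum.distrib sum_subtractf flip: sum_distrib_right)
  moreover have "0 \<le> ((\<Sum>X\<in>\<A>. real (N X)) - real (card \<A>) * (3 * card I / 4)) * ln 3"
    using avg by (intro mult_nonneg_nonneg) auto
  ultimately have "t * card \<A> \<le> 2 ^ card W * 2 ^ card I"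
    using le tpos by (smt (verit) mult_left_mono)
  moreover have "2 ^ card I = t * (16/27) powr (card I / 4)"
  proof -
    have "t = 27 powr (card I / 4)"
      using powr_powr[of 3 3 "card I / 4"] by (simp add: t_def)
    then have "t * (16/27) powr (card I / 4) = 16 powr (card I / 4)"
      by (simp add: powr_divide)
    also have "\<dots> = 2 ^ card I"
      using powr_powr[of 2 4 "card I / 4"] by (simp add: powr_realpow)
    finally show ?thesis by simp
  qed
  ultimately show ?thesis using tpos by (simp add: mult.left_commute)
qed

definition slice :: "bool \<Rightarrow> 'a set set \<Rightarrow> 'a set \<Rightarrow> 'a \<Rightarrow> 'a set set" where
  "slice b \<A> W i = {X. X \<subseteq> W \<and> (i \<in> X) = b \<and> X \<in> \<A>}"

text \<open>If both slices have at least a quarter, they agree up to a constant factor; otherwise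
  one has over 3/4, as \<open>card_family_le_if_biased\<close> requires.\<close>

definition biased :: "'a set set \<Rightarrow> 'a set \<Rightarrow> 'a \<Rightarrow> bool" where
  "biased \<A> W i \<longleftrightarrow>
     4 * card (slice False \<A> W i) < card (\<A> \<inter> Pow W) \<or>
     4 * card (slice True \<A> W i) < card (\<A> \<inter> Pow W)"

lemma finite_slice [simp]: "finite W \<Longrightarrow> finite (slice b \<A> W i)"
  by (rule finite_subset[of _ "Pow W"]) (auto simp: slice_def)

lemma card_slices:
  assumes "finite W"
  shows "card (slice False \<A> W i) + card (slice True \<A> W i) = card (\<A> \<inter> Pow W)"
proof -
  have "\<A> \<inter> Pow W = slice False \<A> W i \<union> slice True \<A> W i"
    by (auto simp: slice_def)
  moreover have "disjnt (slice False \<A> W i) (slice True \<A> W i)"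
    by (auto simp: slice_def disjnt_def)
  ultimately show ?thesis
    using assms by (simp add: card_Un_disjnt)
qed

text \<open>The density that \<open>card_family_le_if_biased\<close> allows when a sixteenth of
  \<open>w\<close> coordinates is biased: the exponent is w / 16 / 4.\<close>

definition err :: "nat \<Rightarrow> real" where
  "err w = (16/27) powr (w / 64)"

text \<open>Let \<open>a\<close> count the subsets of \<open>W\<close> in \<A>. Above density
  \<open>err\<close>, at most 1/16 of the coordinates are biased and contribute at most
  \<open>a\<close> each, while the others contribute at least a / 4 each: (1/16) / (15/64) = 4/15.
  Below it, the additive term covers everything.\<close>

lemma sum_biased_le:
  assumes "finite W"
  shows "(\<Sum>i | i \<in> W \<and> biased \<A> W i. real (card (slice False \<A> W i)))
    \<le> 4/15 * (\<Sum>i\<in>W. real (card (slice False \<A> W i))) + card W * (err (card W) * 2 ^ card W)"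
proof -
  define a where "a = real (card (\<A> \<inter> Pow W))"
  define I where "I = {i\<in>W. biased \<A> W i}"
  let ?a0 = "\<lambda>i. real (card (slice False \<A> W i))"
  have fin: "finite I" "I \<subseteq> W" using assms by (auto simp: I_def)
  have a0: "?a0 i \<le> a" for i
    using card_slices[OF assms, of \<A> i] by (simp add: a_def)
  have sumI: "(\<Sum>i\<in>I. ?a0 i) \<le> card I * a"
    using a0 by (intro sum_bounded_above) auto
  show ?thesis
  proof (cases "a \<le> err (card W) * 2 ^ card W")
    case True
    have "card I * a \<le> card W * (err (card W) * 2 ^ card W)"
      using True fin assms by (intro mult_mono card_mono of_nat_mono) (auto simp: a_def)
    moreover have "0 \<le> (\<Sum>i\<in>W. ?a0 i)" by (intro sum_nonneg) auto
    ultimately show ?thesis using sumI by (auto simp: I_def)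
  next
    case False
    \<comment> \<open>\<open>s\<close> selects the larger slice: it is True when the sets avoiding
      \<open>i\<close> are the rare ones.\<close>
    have "a \<le> 2 ^ card W * (16/27) powr (card I / 4)"
      unfolding a_def
    proof (rule card_family_le_if_biased[OF assms _ fin(2),
          where s = "\<lambda>i. 4 * card (slice False \<A> W i) < card (\<A> \<inter> Pow W)"])
      fix i assume "i \<in> I"
      then have b: "biased \<A> W i" by (simp add: I_def)
      have "{X\<in>\<A> \<inter> Pow W. i \<in> X} = slice True \<A> W i" "{X\<in>\<A> \<inter> Pow W. i \<notin> X} = slice False \<A> W i"
        by (auto simp: slice_def)
      then show "3 * card (\<A> \<inter> Pow W) \<le> 4 * card {X \<in> \<A> \<inter> Pow W.
          (i \<in> X) = (4 * card (slice False \<A> W i) < card (\<A> \<inter> Pow W))}"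
        using b card_slices[OF assms, of \<A> i] unfolding biased_def
        by (cases "4 * card (slice False \<A> W i) < card (\<A> \<inter> Pow W)") auto
    qed auto
    then have "(16/27) powr (card W / 64) < (16/27::real) powr (card I / 4)"
      using False unfolding err_def
      by (smt (verit) mult.commute mult_le_cancel_left_pos zero_less_power)
    then have small: "real (card I) \<le> card W / 16"
      using powr_mono'[of "card W / 64" "card I / 4" "16/27"] by force
    have "(\<Sum>i\<in>W - I. a / 4) \<le> (\<Sum>i\<in>W - I. ?a0 i)"
      by (intro sum_mono) (auto simp: I_def biased_def a_def)
    also have "\<dots> \<le> (\<Sum>i\<in>W. ?a0 i)" using assms by (intro sum_mono2) auto
    finally have "(card W - card I) * (a / 4) \<le> (\<Sum>i\<in>W. ?a0 i)"
      using fin assms card_mono by (simp add: card_Diff_subset of_nat_diff)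
    moreover have "(15/16 * card W) * (a/4) \<le> (card W - card I) * (a / 4)"
      using small by (intro mult_right_mono) (auto simp: a_def)
    moreover have "card I * a \<le> card W / 16 * a"
      using small by (intro mult_right_mono) (auto simp: a_def)
    moreover have "0 \<le> card W * (err (card W) * 2 ^ card W)" by (simp add: err_def)
    ultimately show ?thesis using sumI by (auto simp: I_def mult.commute)
  qed
qed

section \<open>Corruption bound for disjointness\<close>

lemma slice_False_eq: "slice False \<A> W i = \<A> \<inter> Pow (W - {i})"
  by (auto simp: slice_def)

lemma card_slice_UNIV:
  assumes "finite W" "i \<in> W"
  shows "card (slice b UNIV W i) = 2 ^ (card W - 1)"
proof -
  have "card (slice False UNIV W i) = 2 ^ (card W - 1)"
    using assms by (simp add: slice_False_eq card_Pow)
  moreover have "(2::nat) ^ card W = 2 ^ (card W - 1) + 2 ^ (card W - 1)"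
    using assms by (cases "card W") auto
  ultimately show ?thesis
    using card_slices[OF assms(1), of UNIV i] assms by (cases b) (auto simp: card_Pow)
qed

text \<open>In a split \<open>(i, Z)\<close>, Bob's set is drawn from \<open>insert i Z\<close> and Alice's from \<open>U - Z\<close>.\<close>
definition splits :: "'a set \<Rightarrow> nat \<Rightarrow> ('a \<times> 'a set) set" where
  "splits U m = {(i, Z). i \<in> U \<and> Z \<subseteq> U - {i} \<and> card Z = m}"

lemma finite_splits: "finite U \<Longrightarrow> finite (splits U m)"
  by (rule finite_subset[of _ "U \<times> Pow U"]) (auto simp: splits_def)

lemma sum_splits:
  fixes f :: "'a \<Rightarrow> 'a set \<Rightarrow> real"
  assumes "finite U"
  shows "(\<Sum>(i, Z)\<in>splits U m. f i Z) = (\<Sum>Z | Z \<subseteq> U \<and> card Z = m. \<Sum>i\<in>U - Z. f i Z)"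
proof -
  have "(\<Sum>Z | Z \<subseteq> U \<and> card Z = m. \<Sum>i\<in>U - Z. f i Z)
      = (\<Sum>(Z, i)\<in>(SIGMA Z:{Z. Z \<subseteq> U \<and> card Z = m}. U - Z). f i Z)"
    using assms by (intro sum.Sigma) auto
  also have "\<dots> = (\<Sum>(i, Z)\<in>splits U m. f i Z)"
    by (rule sum.reindex_bij_witness[of _ "\<lambda>(i, Z). (Z, i)" "\<lambda>(Z, i). (i, Z)"])
      (auto simp: splits_def)
  finally show ?thesis by simp
qed

text \<open>Both parts have size \<open>m\<close>, so passing to the other part is an involution on
  splits. It exchanges the players and carries bounds for Alice over to Bob.\<close>

lemma complement_splits:
  assumes "finite U" "card U = 2 * m + 1" "(i, Z) \<in> splits U m"
  shows "(i, U - {i} - Z) \<in> splits U m" "U - {i} - (U - {i} - Z) = Z"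
    "U - (U - {i} - Z) = insert i Z"
proof -
  have Z: "i \<in> U" "Z \<subseteq> U - {i}" "card Z = m" "finite Z"
    using assms finite_subset by (auto simp: splits_def)
  have "card (U - {i} - Z) = m"
    using assms Z by (subst card_Diff_subset) auto
  then show "(i, U - {i} - Z) \<in> splits U m" "U - {i} - (U - {i} - Z) = Z"
    "U - (U - {i} - Z) = insert i Z"
    using Z by (auto simp: splits_def)
qed

lemma sum_splits_complement:
  fixes f :: "'a \<Rightarrow> 'a set \<Rightarrow> real"
  assumes "finite U" "card U = 2 * m + 1"
  shows "(\<Sum>(i, Z)\<in>splits U m. f i (U - {i} - Z)) = (\<Sum>(i, Z)\<in>splits U m. f i Z)"
proof -
  have "i \<notin> Z \<and> Z \<subseteq> U" if "(i, Z) \<in> splits U m" for i Z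
    using that by (auto simp: splits_def)
  then show ?thesis
    by (intro sum.reindex_bij_witness[of _ "\<lambda>(i, Z). (i, U - {i} - Z)" "\<lambda>(i, Z). (i, U - {i} - Z)"])
      (use complement_splits(1)[OF assms] in auto)
qed

lemma card_subset_of_split:
  assumes "finite U" "card U = 2 * m + 1" "Z \<subseteq> U" "card Z = m"
  shows "card (U - Z) = m + 1"
  using assms finite_subset[of Z U] by (subst card_Diff_subset) auto

text \<open>For a fixed \<open>Z\<close> only \<open>i\<close> varies, and a disjoint instance restricts Bob's set to \<open>Z\<close>; so Bob's
  contribution is a factor \<open>g Z\<close> that does not depend on \<open>i\<close>.\<close>
lemma sum_splits_biased_le:
  fixes g :: "'a set \<Rightarrow> real"
  assumes "finite U" "card U = 2 * m + 1"
    and g: "\<And>Z. Z \<subseteq> U \<Longrightarrow> card Z = m \<Longrightarrow> 0 \<le> g Z \<and> g Z \<le> 2 ^ m"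
  shows "(\<Sum>(i, Z)\<in>splits U m. of_bool (biased \<A> (U - Z) i) * real (card (slice False \<A> (U - Z) i)) * g Z)
    \<le> 4/15 * (\<Sum>(i, Z)\<in>splits U m. card (slice False \<A> (U - Z) i) * g Z)
      + card (splits U m) * (err (m + 1) * 2 ^ (2 * m + 1))"
proof -
  let ?\<Z> = "{Z. Z \<subseteq> U \<and> card Z = m}"
  let ?a = "\<lambda>i Z. real (card (slice False \<A> (U - Z) i))"
  have "(\<Sum>i\<in>U - Z. of_bool (biased \<A> (U - Z) i) * ?a i Z * g Z)
      \<le> 4/15 * (\<Sum>i\<in>U - Z. ?a i Z * g Z) + (\<Sum>i\<in>U - Z. err (m + 1) * 2 ^ (2 * m + 1))"
    if Z: "Z \<subseteq> U" "card Z = m" for Z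
  proof -
    have c: "card (U - Z) = m + 1" using card_subset_of_split[OF assms(1,2) Z] .
    have pow: "(2::real) ^ (2 * m + 1) = 2 ^ (m + 1) * 2 ^ m"
      unfolding mult_2 power_add by (simp only: mult_ac)
    have "(\<Sum>i\<in>U - Z. of_bool (biased \<A> (U - Z) i) * ?a i Z)
        = (\<Sum>i | i \<in> U - Z \<and> biased \<A> (U - Z) i. ?a i Z)"
      using assms(1) by (intro sum.mono_neutral_cong_right) auto
    also have "\<dots> \<le> 4/15 * (\<Sum>i\<in>U - Z. ?a i Z) + (m + 1) * (err (m + 1) * 2 ^ (m + 1))"
      using sum_biased_le[of "U - Z" \<A>] assms(1) c by simp
    finally have "(\<Sum>i\<in>U - Z. of_bool (biased \<A> (U - Z) i) * ?a i Z) * g Z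
        \<le> (4/15 * (\<Sum>i\<in>U - Z. ?a i Z) + (m + 1) * (err (m + 1) * 2 ^ (m + 1))) * g Z"
      using g[OF Z] by (intro mult_right_mono) auto
    moreover have "(m + 1) * (err (m + 1) * 2 ^ (m + 1)) * g Z
        \<le> (m + 1) * (err (m + 1) * 2 ^ (m + 1)) * 2 ^ m"
      using g[OF Z] by (intro mult_left_mono) (auto simp: err_def)
    moreover have "(m + 1) * (err (m + 1) * 2 ^ (m + 1)) * 2 ^ m
        = (\<Sum>i\<in>U - Z. err (m + 1) * 2 ^ (2 * m + 1))"
      unfolding sum_constant c pow by (simp only: mult.assoc)
    ultimately show ?thesis
      by (simp add: sum_distrib_right distrib_right mult.assoc)
  qed
  then have "(\<Sum>Z\<in>?\<Z>. \<Sum>i\<in>U - Z. of_bool (biased \<A> (U - Z) i) * ?a i Z * g Z)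
      \<le> (\<Sum>Z\<in>?\<Z>. 4/15 * (\<Sum>i\<in>U - Z. ?a i Z * g Z) + (\<Sum>i\<in>U - Z. err (m + 1) * 2 ^ (2 * m + 1)))"
    by (intro sum_mono) auto
  also have "\<dots> = 4/15 * (\<Sum>Z\<in>?\<Z>. \<Sum>i\<in>U - Z. ?a i Z * g Z)
      + (\<Sum>Z\<in>?\<Z>. \<Sum>i\<in>U - Z. err (m + 1) * 2 ^ (2 * m + 1))"
    by (simp add: sum.distrib sum_distrib_left)
  finally show ?thesis
    unfolding sum_splits[OF assms(1), symmetric] by (simp add: case_prod_unfold)
qed

text \<open>Where \<open>i\<close> is unbiased for both families, each disjoint count is at most 4
  times the intersecting one, hence the product at most 16 times. Up to the error, biased splits
  carry at most 4/15 of the disjoint sum per player; 8/15 < 1 can be absorbed.\<close>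

lemma disjointness_corruption:
  assumes "finite U" "card U = 2 * m + 1"
  shows "(\<Sum>(i, Z)\<in>splits U m. real (card (slice False \<A> (U - Z) i) * card (slice False \<B> (insert i Z) i)))
    \<le> 35 * (\<Sum>(i, Z)\<in>splits U m. real (card (slice True \<A> (U - Z) i) * card (slice True \<B> (insert i Z) i)))
      + 9 * (card (splits U m) * (err (m + 1) * 2 ^ (2 * m)))"
proof -
  let ?S = "splits U m"
  define a b where "a \<beta> i Z = real (card (slice \<beta> \<A> (U - Z) i))"
    and "b \<beta> i Z = real (card (slice \<beta> \<B> (insert i Z) i))" for \<beta> i Z
  define E where "E = card ?S * (err (m + 1) * 2 ^ (2 * m + 1))"
  let ?D = "\<Sum>(i, Z)\<in>?S. a False i Z * b False i Z"
  have bound: "real (card (\<C> \<inter> Pow Z)) \<le> 2 ^ m" if "Z \<subseteq> U" "card Z = m" for \<C> Z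
  proof -
    have "card (\<C> \<inter> Pow Z) \<le> card (Pow Z)"
      using that assms(1) finite_subset by (intro card_mono) auto
    also have "\<dots> = 2 ^ m" using that assms(1) finite_subset by (metis card_Pow)
    finally show ?thesis using of_nat_mono by fastforce
  qed
  have b0: "b False i Z = real (card (\<B> \<inter> Pow Z))" if "(i, Z) \<in> ?S" for i Z
  proof -
    have "insert i Z - {i} = Z" using that by (auto simp: splits_def)
    then show ?thesis by (simp only: b_def slice_False_eq)
  qed
  have "(\<Sum>(i, Z)\<in>?S. of_bool (biased \<A> (U - Z) i) * (a False i Z * b False i Z))
      = (\<Sum>(i, Z)\<in>?S. of_bool (biased \<A> (U - Z) i) * real (card (slice False \<A> (U - Z) i)) * real (card (\<B> \<inter> Pow Z)))"
    by (intro sum.cong) (auto simp: a_def b0)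
  also have "\<dots> \<le> 4/15 * (\<Sum>(i, Z)\<in>?S. real (card (slice False \<A> (U - Z) i)) * real (card (\<B> \<inter> Pow Z))) + E"
    unfolding E_def
    by (rule sum_splits_biased_le[OF assms, of "\<lambda>Z. real (card (\<B> \<inter> Pow Z))" \<A>])
      (use bound in auto)
  also have "(\<Sum>(i, Z)\<in>?S. real (card (slice False \<A> (U - Z) i)) * real (card (\<B> \<inter> Pow Z))) = ?D"
    by (intro sum.cong) (auto simp: a_def b0)
  finally have bad_a: "(\<Sum>(i, Z)\<in>?S. of_bool (biased \<A> (U - Z) i) * (a False i Z * b False i Z))
      \<le> 4/15 * ?D + E" .
  \<comment> \<open>Over the complementary split, Alice's factor depends on the part alone, the form
    \<open>sum_splits_biased_le\<close> expects for a bound on Bob's bias.\<close>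
  have comp: "of_bool (biased \<B> (insert i Z) i) * (a False i Z * b False i Z)
      = of_bool (biased \<B> (U - (U - {i} - Z)) i) * card (slice False \<B> (U - (U - {i} - Z)) i)
        * card (\<A> \<inter> Pow (U - {i} - Z))"
    "a False i Z * b False i Z
      = card (slice False \<B> (U - (U - {i} - Z)) i) * card (\<A> \<inter> Pow (U - {i} - Z))"
    if "(i, Z) \<in> ?S" for i Z
  proof -
    have "U - Z - {i} = U - {i} - Z" by auto
    then show "of_bool (biased \<B> (insert i Z) i) * (a False i Z * b False i Z)
      = of_bool (biased \<B> (U - (U - {i} - Z)) i) * card (slice False \<B> (U - (U - {i} - Z)) i)
        * card (\<A> \<inter> Pow (U - {i} - Z))"
      "a False i Z * b False i Z
      = card (slice False \<B> (U - (U - {i} - Z)) i) * card (\<A> \<inter> Pow (U - {i} - Z))"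
      unfolding complement_splits(3)[OF assms that] a_def b_def
      by (simp_all add: slice_False_eq[of \<A>])
  qed
  have "(\<Sum>(i, Z)\<in>?S. of_bool (biased \<B> (insert i Z) i) * (a False i Z * b False i Z))
      = (\<Sum>(i, Z)\<in>?S. of_bool (biased \<B> (U - (U - {i} - Z)) i)
          * real (card (slice False \<B> (U - (U - {i} - Z)) i)) * real (card (\<A> \<inter> Pow (U - {i} - Z))))"
    using comp(1) by (intro sum.cong) auto
  also have "\<dots> = (\<Sum>(i, Z)\<in>?S. of_bool (biased \<B> (U - Z) i)
          * real (card (slice False \<B> (U - Z) i)) * real (card (\<A> \<inter> Pow Z)))"
    by (rule sum_splits_complement[OF assms])
  also have "\<dots> \<le> 4/15 * (\<Sum>(i, Z)\<in>?S. real (card (slice False \<B> (U - Z) i)) * real (card (\<A> \<inter> Pow Z))) + E"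
    unfolding E_def
    by (rule sum_splits_biased_le[OF assms, of "\<lambda>Z. real (card (\<A> \<inter> Pow Z))" \<B>])
      (use bound in auto)
  also have "(\<Sum>(i, Z)\<in>?S. real (card (slice False \<B> (U - Z) i)) * real (card (\<A> \<inter> Pow Z)))
      = (\<Sum>(i, Z)\<in>?S. real (card (slice False \<B> (U - (U - {i} - Z)) i)) * real (card (\<A> \<inter> Pow (U - {i} - Z))))"
    by (rule sum_splits_complement[OF assms, symmetric])
  also have "\<dots> = ?D"
    using comp(2) by (intro sum.cong) auto
  finally have bad_b: "(\<Sum>(i, Z)\<in>?S. of_bool (biased \<B> (insert i Z) i) * (a False i Z * b False i Z))
      \<le> 4/15 * ?D + E" .
  have pt: "a False i Z * b False i Z \<le> 16 * (a True i Z * b True i Z)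
      + of_bool (biased \<A> (U - Z) i) * (a False i Z * b False i Z)
      + of_bool (biased \<B> (insert i Z) i) * (a False i Z * b False i Z)"
    if "(i, Z) \<in> ?S" for i Z
  proof -
    have fin: "finite (U - Z)" "finite (insert i Z)"
      using that assms(1) finite_subset by (auto simp: splits_def)
    have nn: "0 \<le> a \<beta> i Z" "0 \<le> b \<beta> i Z" for \<beta> by (auto simp: a_def b_def)
    show ?thesis
    proof (cases "biased \<A> (U - Z) i \<or> biased \<B> (insert i Z) i")
      case True
      then show ?thesis using nn by auto
    next
      case False
      then have "a False i Z \<le> 4 * a True i Z" "b False i Z \<le> 4 * b True i Z"
        using card_slices[OF fin(1), of \<A> i] card_slices[OF fin(2), of \<B> i]
        by (auto simp: biased_def a_def b_def)
      then have "a False i Z * b False i Z \<le> (4 * a True i Z) * (4 * b True i Z)"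
        using nn by (intro mult_mono) auto
      then show ?thesis using nn by simp
    qed
  qed
  have "?D \<le> (\<Sum>(i, Z)\<in>?S. 16 * (a True i Z * b True i Z)
      + of_bool (biased \<A> (U - Z) i) * (a False i Z * b False i Z)
      + of_bool (biased \<B> (insert i Z) i) * (a False i Z * b False i Z))"
    using pt by (intro sum_mono) auto
  also have "\<dots> = 16 * (\<Sum>(i, Z)\<in>?S. a True i Z * b True i Z)
      + (\<Sum>(i, Z)\<in>?S. of_bool (biased \<A> (U - Z) i) * (a False i Z * b False i Z))
      + (\<Sum>(i, Z)\<in>?S. of_bool (biased \<B> (insert i Z) i) * (a False i Z * b False i Z))"
    by (simp add: sum.distrib case_prod_unfold sum_distrib_left)
  finally have fin: "?D \<le> 16 * (\<Sum>(i, Z)\<in>?S. a True i Z * b True i Z) + 8/15 * ?D + 2 * E"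
    using bad_a bad_b by linarith
  moreover have "0 \<le> (\<Sum>(i, Z)\<in>?S. a True i Z * b True i Z)"
    by (intro sum_nonneg) (auto simp: a_def b_def)
  moreover have "E = 2 * (card ?S * (err (m + 1) * 2 ^ (2 * m)))" "0 \<le> E"
    by (simp_all add: E_def err_def)
  \<comment> \<open>Absorbing 8/15 of the sum multiplies the rest by 15/7: 16 * 15/7 < 35, and 2 * 2
    * 15/7 < 9 because \<open>E\<close> is twice the stated error.\<close>
  ultimately have "?D \<le> 35 * (\<Sum>(i, Z)\<in>?S. a True i Z * b True i Z)
      + 9 * (card ?S * (err (m + 1) * 2 ^ (2 * m)))"
    by linarith
  then show ?thesis by (simp add: a_def b_def)
qed

section \<open>Direct product for corruption\<close>

text \<open>The geometric mean of \<open>s \<le> s\<close> and \<open>s - e \<le> a t\<close>, linearised by AM-GM.\<close>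
lemma le_amgm:
  fixes s a t e l :: real
  assumes "0 \<le> s" "0 \<le> a" "0 \<le> t" "0 \<le> e" "l > 0" "s \<le> a * t + e"
  shows "s \<le> (l * (a * s) + t / l) / 2 + e"
proof (cases "s \<le> e")
  case True
  then show ?thesis using assms by (simp add: add_increasing)
next
  case False
  have "(s - e)\<^sup>2 \<le> s * (s - e)"
    using False assms by (simp add: power2_eq_square mult_right_mono)
  also have "\<dots> \<le> s * (a * t)" using assms by (intro mult_left_mono) auto
  also have "\<dots> = (l * (a * s)) * (t / l)" using assms by simp
  also have "\<dots> \<le> ((l * (a * s) + t / l) / 2)\<^sup>2"
    using sum_squares_ge_zero[of "l * (a * s) - t / l" 0]
    by (simp add: power2_eq_square algebra_simps)
  finally have "s - e \<le> (l * (a * s) + t / l) / 2"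
    by (rule power2_le_imp_le) (use assms in auto)
  then show ?thesis by linarith
qed

lemma power_add_le_power_Suc_max: "(2::real) ^ b + 2 ^ a \<le> 2 ^ Suc (max a b)"
proof -
  have "(2::real) ^ a \<le> 2 ^ max a b" "(2::real) ^ b \<le> 2 ^ max a b"
    by (auto intro: power_increasing)
  then show ?thesis unfolding power_Suc by linarith
qed

text \<open>Isolates what the direct product needs of disjointness. Corruption is one-sided: only a
  claimed True gains a factor \<alpha>. By \<open>balanced\<close>, half of the labels are True on
  average.\<close>

locale corrupted_instance =
  fixes \<Omega> :: "'w set" and fx :: "'w \<Rightarrow> 'x" and fy :: "'w \<Rightarrow> 'y" and d :: "'w \<Rightarrow> bool"
    and \<alpha> \<eta> :: real
  assumes finite_inst: "finite \<Omega>" and inst_ne: "\<Omega> \<noteq> {}"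
    and \<alpha>: "0 \<le> \<alpha>" "\<alpha> \<le> 1" and \<eta>: "0 \<le> \<eta>"
    and balanced: "2 * card {\<omega>\<in>\<Omega>. d \<omega>} = card \<Omega>"
    and corruption: "\<And>A B. real (card {\<omega>\<in>\<Omega>. d \<omega> \<and> fx \<omega> \<in> A \<and> fy \<omega> \<in> B})
      \<le> \<alpha> * card {\<omega>\<in>\<Omega>. fx \<omega> \<in> A \<and> fy \<omega> \<in> B} + \<eta> * card \<Omega>"
begin

definition tuples :: "nat \<Rightarrow> 'w list set" where
  "tuples k = {ws. set ws \<subseteq> \<Omega> \<and> length ws = k}"

lemma finite_tuples [simp]: "finite (tuples k)"
  unfolding tuples_def using finite_inst by (rule finite_lists_length_eq)

lemma card_tuples: "card (tuples k) = card \<Omega> ^ k"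
  unfolding tuples_def using finite_inst by (rule card_lists_length_eq)

lemma tuples_0 [simp]: "tuples 0 = {[]}"
  by (auto simp: tuples_def)

lemma sum_tuples_Suc:
  fixes f :: "'w list \<Rightarrow> real"
  shows "(\<Sum>ws\<in>tuples (Suc k). f ws) = (\<Sum>\<omega>\<in>\<Omega>. \<Sum>ws\<in>tuples k. f (\<omega> # ws))"
proof -
  have "(\<Sum>\<omega>\<in>\<Omega>. \<Sum>ws\<in>tuples k. f (\<omega> # ws)) = (\<Sum>(\<omega>, ws)\<in>\<Omega> \<times> tuples k. f (\<omega> # ws))"
    by (rule sum.cartesian_product)
  also have "\<dots> = (\<Sum>ws\<in>tuples (Suc k). f ws)"
    by (rule sum.reindex_bij_witness[of _ "\<lambda>ws. (hd ws, tl ws)" "\<lambda>(\<omega>, ws). \<omega> # ws"])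
      (auto simp: tuples_def length_Suc_conv)
  finally show ?thesis by simp
qed

abbreviation ones :: "bool list \<Rightarrow> nat" where
  "ones w \<equiv> count_list w True"

definition rect :: "'x list set \<Rightarrow> 'y list set \<Rightarrow> 'w list \<Rightarrow> real" where
  "rect A B ws = of_bool (map fx ws \<in> A \<and> map fy ws \<in> B)"

lemma rect_bounds: "0 \<le> rect A B ws" "rect A B ws \<le> 1"
  by (auto simp: rect_def)

text \<open>With the tail \<open>ws\<close> fixed, the head again ranges over a rectangle, so
  \<open>corruption\<close> applies.\<close>

lemma sum_labelled_le:
  "(\<Sum>\<omega>\<in>\<Omega>. of_bool (d \<omega> = b) * rect A B (\<omega> # ws))
    \<le> (if b then \<alpha> else 1) * (\<Sum>\<omega>\<in>\<Omega>. rect A B (\<omega> # ws)) + \<eta> * card \<Omega>"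
proof (cases b)
  case True
  define A' B' where "A' = {x. x # map fx ws \<in> A}" and "B' = {y. y # map fy ws \<in> B}"
  have "(\<Sum>\<omega>\<in>\<Omega>. of_bool (d \<omega>) * rect A B (\<omega> # ws)) = card {\<omega>\<in>\<Omega>. d \<omega> \<and> fx \<omega> \<in> A' \<and> fy \<omega> \<in> B'}"
    using finite_inst
    by (simp add: rect_def A'_def B'_def Int_def flip: of_bool_conj)
  moreover have "(\<Sum>\<omega>\<in>\<Omega>. rect A B (\<omega> # ws)) = card {\<omega>\<in>\<Omega>. fx \<omega> \<in> A' \<and> fy \<omega> \<in> B'}"
    using finite_inst by (simp add: rect_def A'_def B'_def Int_def)
  ultimately show ?thesis using corruption[of A' B'] True by simp
next
  case False
  have "(\<Sum>\<omega>\<in>\<Omega>. of_bool (\<not> d \<omega>) * rect A B (\<omega> # ws)) \<le> (\<Sum>\<omega>\<in>\<Omega>. rect A B (\<omega> # ws))"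
    by (intro sum_mono) (auto simp: rect_def)
  moreover have "0 \<le> \<eta> * card \<Omega>" using \<eta> by simp
  ultimately show ?thesis using False by simp
qed

text \<open>For each fixed head, the induction hypothesis removes the label condition on the tail;
  then for each fixed tail only a condition on the head remains. Each coordinate adds one \<eta> to
  the error.\<close>

lemma product_corruption:
  "length w = k \<Longrightarrow>
    (\<Sum>ws\<in>tuples k. of_bool (map d ws = w) * rect A B ws)
      \<le> \<alpha> ^ ones w * (\<Sum>ws\<in>tuples k. rect A B ws) + k * \<eta> * card \<Omega> ^ k"
proof (induction w arbitrary: k A B)
  case Nil
  then show ?case by (simp add: rect_def)
next
  case (Cons b w)
  then obtain j where k: "k = Suc j" and j: "length w = j" by (cases k) auto
  define c where "c = real (card \<Omega>)"
  have shift: "rect A B (\<omega> # ws) = rect {xs. fx \<omega> # xs \<in> A} {ys. fy \<omega> # ys \<in> B} ws" for \<omega> ws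
    by (simp add: rect_def)
  have IH: "(\<Sum>ws\<in>tuples j. of_bool (map d ws = w) * rect A B (\<omega> # ws))
      \<le> \<alpha> ^ ones w * (\<Sum>ws\<in>tuples j. rect A B (\<omega> # ws)) + j * \<eta> * c ^ j" for \<omega>
    using Cons.IH[OF j, of "{xs. fx \<omega> # xs \<in> A}" "{ys. fy \<omega> # ys \<in> B}"] by (simp add: shift c_def)
  have "(\<Sum>ws\<in>tuples k. of_bool (map d ws = b # w) * rect A B ws)
      = (\<Sum>\<omega>\<in>\<Omega>. of_bool (d \<omega> = b) * (\<Sum>ws\<in>tuples j. of_bool (map d ws = w) * rect A B (\<omega> # ws)))"
    unfolding k sum_tuples_Suc sum_distrib_left by (intro sum.cong refl) auto
  also have "\<dots> \<le> (\<Sum>\<omega>\<in>\<Omega>. of_bool (d \<omega> = b) * (\<alpha> ^ ones w * (\<Sum>ws\<in>tuples j. rect A B (\<omega> # ws)))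
      + j * \<eta> * c ^ j)"
  proof (intro sum_mono)
    fix \<omega>
    show "of_bool (d \<omega> = b) * (\<Sum>ws\<in>tuples j. of_bool (map d ws = w) * rect A B (\<omega> # ws))
        \<le> of_bool (d \<omega> = b) * (\<alpha> ^ ones w * (\<Sum>ws\<in>tuples j. rect A B (\<omega> # ws))) + j * \<eta> * c ^ j"
      using IH[of \<omega>] \<eta> by (auto simp: c_def)
  qed
  also have "\<dots> = \<alpha> ^ ones w * (\<Sum>ws\<in>tuples j. \<Sum>\<omega>\<in>\<Omega>. of_bool (d \<omega> = b) * rect A B (\<omega> # ws))
      + j * \<eta> * c ^ k"
    by (subst sum.swap)
      (simp add: sum.distrib sum_distrib_left mult_ac k c_def del: sum_mult_of_bool_eq sum_of_bool_mult_eq)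
  also have "(\<Sum>ws\<in>tuples j. \<Sum>\<omega>\<in>\<Omega>. of_bool (d \<omega> = b) * rect A B (\<omega> # ws))
      \<le> (\<Sum>ws\<in>tuples j. (if b then \<alpha> else 1) * (\<Sum>\<omega>\<in>\<Omega>. rect A B (\<omega> # ws)) + \<eta> * c)"
    unfolding c_def by (intro sum_mono sum_labelled_le)
  also have "\<dots> = (if b then \<alpha> else 1) * (\<Sum>ws\<in>tuples k. rect A B ws) + \<eta> * c ^ k"
    unfolding k sum_tuples_Suc
    by (subst sum.swap[of _ "tuples j"]) (simp add: sum.distrib card_tuples c_def mult_ac flip: sum_distrib_left)
  finally have "(\<Sum>ws\<in>tuples k. of_bool (map d ws = b # w) * rect A B ws)
      \<le> \<alpha> ^ ones w * ((if b then \<alpha> else 1) * (\<Sum>ws\<in>tuples k. rect A B ws) + \<eta> * c ^ k)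
        + j * \<eta> * c ^ k"
    using \<alpha> by (simp add: mult_left_mono)
  also have "\<dots> \<le> \<alpha> ^ ones (b # w) * (\<Sum>ws\<in>tuples k. rect A B ws) + 1 * (\<eta> * c ^ k) + j * \<eta> * c ^ k"
  proof -
    have "\<alpha> ^ ones w * (\<eta> * c ^ k) \<le> 1 * (\<eta> * c ^ k)"
      using \<alpha> \<eta> by (intro mult_right_mono power_le_one) (auto simp: c_def)
    then show ?thesis by (cases b) (simp_all add: algebra_simps)
  qed
  finally show ?case by (simp add: k c_def algebra_simps)
qed

text \<open>Under the uniform distribution the labels are independent fair bits, so their generating
  function is a product.\<close>

lemma sum_power_ones:
  "(\<Sum>ws\<in>tuples k. \<alpha> ^ ones (map d ws)) = ((1 + \<alpha>) / 2 * card \<Omega>) ^ k"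
proof (induction k)
  case 0
  then show ?case by simp
next
  case (Suc k)
  have "card \<Omega> = card {\<omega>\<in>\<Omega>. d \<omega>} + card {\<omega>\<in>\<Omega>. \<not> d \<omega>}"
    using finite_inst by (subst card_Un_disjoint[symmetric]) (auto intro: arg_cong[of _ _ card])
  then have "card {\<omega>\<in>\<Omega>. \<not> d \<omega>} = card {\<omega>\<in>\<Omega>. d \<omega>}" "real (card \<Omega>) = 2 * card {\<omega>\<in>\<Omega>. d \<omega>}"
    using balanced by linarith+
  then have "(\<Sum>\<omega>\<in>\<Omega>. if d \<omega> then \<alpha> else 1) = (1 + \<alpha>) / 2 * card \<Omega>"
    using finite_inst by (simp add: sum.If_cases Int_def algebra_simps)
  moreover have "(\<Sum>ws\<in>tuples (Suc k). \<alpha> ^ ones (map d ws))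
      = (\<Sum>\<omega>\<in>\<Omega>. (if d \<omega> then \<alpha> else 1) * (\<Sum>ws\<in>tuples k. \<alpha> ^ ones (map d ws)))"
    unfolding sum_tuples_Suc sum_distrib_left by (intro sum.cong) auto
  ultimately show ?case using Suc by (simp flip: sum_distrib_right)
qed

text \<open>The corruption factor varies with the output of the leaf. After AM-GM the main terms are
  sums over the tuples of the rectangle, hence additive when a message splits it; only the error
  grows with the number of leaves. \<open>l\<close> is common to all leaves and chosen
  later.\<close>

lemma correct_on_rect_le:
  fixes p :: "('x list, 'y list, bool list) protocol"
  assumes "l > 0"
  shows "(\<Sum>ws\<in>tuples k. of_bool (run p (map fx ws) (map fy ws) = map d ws) * rect A B ws)
    \<le> (l * (\<Sum>ws\<in>tuples k. \<alpha> ^ ones (map d ws) * rect A B ws) + (\<Sum>ws\<in>tuples k. rect A B ws) / l) / 2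
      + 2 ^ cost p * (k * \<eta> * card \<Omega> ^ k)"
    (is "?L p A B \<le> (l * ?M A B + ?T A B / l) / 2 + 2 ^ cost p * ?e")
proof (induction p arbitrary: A B)
  case (Leaf w)
  have e: "0 \<le> ?e" using \<eta> by simp
  have nn: "0 \<le> ?M A B" "0 \<le> ?T A B"
    using \<alpha> by (auto intro!: sum_nonneg mult_nonneg_nonneg simp: rect_bounds)
  show ?case
  proof (cases "length w = k")
    case True
    let ?s = "\<Sum>ws\<in>tuples k. of_bool (map d ws = w) * rect A B ws"
    have "?s \<le> (l * (\<alpha> ^ ones w * ?s) + ?T A B / l) / 2 + ?e"
      using \<alpha> \<eta> assms nn e product_corruption[OF True, of A B]
      by (intro le_amgm sum_nonneg mult_nonneg_nonneg) (auto simp: rect_bounds)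
    \<comment> \<open>Correct tuples satisfy \<open>map d ws = w\<close>, so the exponent of the
      leaf becomes that of each tuple.\<close>
    moreover have "\<alpha> ^ ones w * ?s \<le> ?M A B"
      unfolding sum_distrib_left using \<alpha> by (intro sum_mono) (auto simp: rect_bounds)
    then have "l * (\<alpha> ^ ones w * ?s) \<le> l * ?M A B" using assms by (intro mult_left_mono) auto
    moreover have "?L (Leaf w) A B = ?s" by (simp add: eq_commute)
    moreover have "s \<le> (y + t) / 2 + 2 ^ cost (Leaf w :: ('x list, 'y list, bool list) protocol) * e"
      if "s' \<le> (x + t) / 2 + e" "x \<le> y" "s = s'" for s s' t x y e :: real
      using that by (auto simp: field_simps)
    ultimately show ?thesis by blast
  next
    case False
    then have "?L (Leaf w) A B = 0" by (intro sum.neutral) (auto simp: tuples_def)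
    then show ?thesis using nn e assms by simp
  qed
next
  case (AliceSends f p0 p1)
  let ?A1 = "A \<inter> {x. f x}" and ?A0 = "A \<inter> {x. \<not> f x}"
  have r: "rect A B ws = rect ?A1 B ws + rect ?A0 B ws" for ws by (auto simp: rect_def)
  have "?L (AliceSends f p0 p1) A B = ?L p1 ?A1 B + ?L p0 ?A0 B"
    unfolding sum.distrib[symmetric] by (intro sum.cong) (auto simp: rect_def)
  moreover have "?M A B = ?M ?A1 B + ?M ?A0 B" "?T A B = ?T ?A1 B + ?T ?A0 B"
    by (simp_all add: r sum.distrib distrib_left)
  moreover have "2 ^ cost p1 * ?e + 2 ^ cost p0 * ?e \<le> 2 ^ cost (AliceSends f p0 p1) * ?e"
    unfolding distrib_right[symmetric] cost.simps
    by (rule mult_right_mono[OF power_add_le_power_Suc_max]) (use \<eta> in simp)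
  ultimately show ?case using AliceSends(1)[of ?A0 B] AliceSends(2)[of ?A1 B]
    by (simp add: algebra_simps add_divide_distrib)
next
  case (BobSends g p0 p1)
  let ?B1 = "B \<inter> {y. g y}" and ?B0 = "B \<inter> {y. \<not> g y}"
  have r: "rect A B ws = rect A ?B1 ws + rect A ?B0 ws" for ws by (auto simp: rect_def)
  have "?L (BobSends g p0 p1) A B = ?L p1 A ?B1 + ?L p0 A ?B0"
    unfolding sum.distrib[symmetric] by (intro sum.cong) (auto simp: rect_def)
  moreover have "?M A B = ?M A ?B1 + ?M A ?B0" "?T A B = ?T A ?B1 + ?T A ?B0"
    by (simp_all add: r sum.distrib distrib_left)
  moreover have "2 ^ cost p1 * ?e + 2 ^ cost p0 * ?e \<le> 2 ^ cost (BobSends g p0 p1) * ?e"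
    unfolding distrib_right[symmetric] cost.simps
    by (rule mult_right_mono[OF power_add_le_power_Suc_max]) (use \<eta> in simp)
  ultimately show ?case using BobSends(1)[of A ?B0] BobSends(2)[of A ?B1]
    by (simp add: algebra_simps add_divide_distrib)
qed

text \<open>With r^2 = (1 + \<alpha>) / 2, \<open>sum_power_ones\<close> makes the weighted sum
  r^(2k) times the number of tuples, so l = 1 / r^k balances the two main terms.\<close>

lemma deterministic_correct_le:
  fixes p :: "('x list, 'y list, bool list) protocol"
  shows "(\<Sum>ws\<in>tuples k. of_bool (run p (map fx ws) (map fy ws) = map d ws))
    \<le> (sqrt ((1 + \<alpha>) / 2) ^ k + 2 ^ cost p * (k * \<eta>)) * real (card (tuples k))"
proof -
  define r where "r = sqrt ((1 + \<alpha>) / 2)"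
  have r: "r > 0" "r\<^sup>2 = (1 + \<alpha>) / 2" using \<alpha> by (auto simp: r_def)
  have "(\<Sum>ws\<in>tuples k. of_bool (run p (map fx ws) (map fy ws) = map d ws))
      \<le> (1 / r ^ k * ((1 + \<alpha>) / 2 * card \<Omega>) ^ k + card (tuples k) / (1 / r ^ k)) / 2
        + 2 ^ cost p * (k * \<eta> * card \<Omega> ^ k)"
    using correct_on_rect_le[where l = "1 / r ^ k" and p = p and k = k and A = UNIV and B = UNIV] r(1) sum_power_ones[of k]
    by (simp add: rect_def)
  also have "1 / r ^ k * ((1 + \<alpha>) / 2 * card \<Omega>) ^ k = r ^ k * card (tuples k)"
    using r(1) unfolding r(2)[symmetric]
    by (simp add: card_tuples power_mult_distrib power2_eq_square)
  finally show ?thesis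
    by (simp add: r_def card_tuples algebra_simps)
qed

text \<open>The easy half of Yao's principle: if every tuple violated the bound, so would their
  average, yet each deterministic protocol in the support obeys it on average.\<close>

lemma randomized_hard_input:
  fixes P :: "('x list, 'y list, bool list) protocol pmf"
  assumes "\<And>p. p \<in> set_pmf P \<Longrightarrow> cost p \<le> c"
  shows "\<exists>ws\<in>tuples k. success_prob P (map fx ws) (map fy ws) (map d ws)
    \<le> sqrt ((1 + \<alpha>) / 2) ^ k + 2 ^ c * (k * \<eta>)"
proof (rule ccontr)
  define b where "b = sqrt ((1 + \<alpha>) / 2) ^ k + 2 ^ c * (k * \<eta>)"
  define E where "E ws = {p. run p (map fx ws) (map fy ws) = map d ws}" for ws
  assume "\<not> ?thesis"
  then have gt: "b < measure_pmf.prob P (E ws)" if "ws \<in> tuples k" for ws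
    using that by (force simp: success_prob_def E_def b_def)
  have ne: "tuples k \<noteq> {}"
    using inst_ne finite_inst card_tuples[of k] by (metis card.empty card_0_eq power_eq_0_iff)
  have "card (tuples k) * b < (\<Sum>ws\<in>tuples k. measure_pmf.prob P (E ws))"
    using ne gt sum_strict_mono[of "tuples k" "\<lambda>_. b"] by simp
  also have "\<dots> = measure_pmf.expectation P (\<lambda>p. \<Sum>ws\<in>tuples k. indicator (E ws) p)"
    by (subst Bochner_Integration.integral_sum) (auto intro!: integrable_real_indicator simp: less_top[symmetric])
  also have "\<dots> \<le> b * card (tuples k)"
  proof (rule measure_pmf.integral_le_const)
    show "integrable P (\<lambda>p. \<Sum>ws\<in>tuples k. indicator (E ws) p :: real)"
      by (intro Bochner_Integration.integrable_sum) (auto intro!: integrable_real_indicator simp: less_top[symmetric])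
    show "AE p in P. (\<Sum>ws\<in>tuples k. indicator (E ws) p) \<le> b * card (tuples k)"
      unfolding AE_measure_pmf_iff
    proof
      fix p assume "p \<in> set_pmf P"
      then have "(2::real) ^ cost p \<le> 2 ^ c" using assms by (intro power_increasing) auto
      then have "2 ^ cost p * (k * \<eta>) \<le> 2 ^ c * (k * \<eta>)" using \<eta> by (intro mult_right_mono) auto
      then have "sqrt ((1 + \<alpha>) / 2) ^ k + 2 ^ cost p * (k * \<eta>) \<le> b" by (simp add: b_def)
      then have "(sqrt ((1 + \<alpha>) / 2) ^ k + 2 ^ cost p * (k * \<eta>)) * real (card (tuples k))
          \<le> b * card (tuples k)"
        by (intro mult_right_mono) auto
      then show "(\<Sum>ws\<in>tuples k. indicator (E ws) p) \<le> b * card (tuples k)"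
        using deterministic_correct_le[where p = p and k = k] by (simp add: E_def indicator_def of_bool_def)
    qed
  qed
  finally show False by (simp add: mult.commute)
qed

end

section \<open>The hard distribution\<close>

definition encode :: "nat \<Rightarrow> nat set \<Rightarrow> bool list" where
  "encode n X = map (\<lambda>i. i \<in> X) [0..<n]"

lemma DISJ_encode: "DISJ (encode n X) (encode n Y) \<longleftrightarrow> X \<inter> Y \<inter> {..<n} = {}"
  by (auto simp: DISJ_def encode_def)

text \<open>The leading bit says whether Alice's and Bob's sets (the last two components) intersect, necessarily in \<open>i\<close>.\<close>
type_synonym disj_instance = "bool \<times> (nat \<times> nat set) \<times> nat set \<times> nat set"

text \<open>Both slices have 2 ^ m sets for every bit and split, so a uniform element has a fair bit
  and a uniform split. Keeping the split counts a pair of sets once for each split it comes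
  from.\<close>

definition instances :: "nat \<Rightarrow> disj_instance set" where
  "instances m = (SIGMA b:UNIV. SIGMA (i, Z):splits {..<2 * m + 1} m.
     slice b UNIV ({..<2 * m + 1} - Z) i \<times> slice b UNIV (insert i Z) i)"

definition alice :: "nat \<Rightarrow> disj_instance \<Rightarrow> bool list" where
  "alice n = (\<lambda>(b, T, X, Y). encode n X)"

definition bob :: "nat \<Rightarrow> disj_instance \<Rightarrow> bool list" where
  "bob n = (\<lambda>(b, T, X, Y). encode n Y)"

lemma DISJ_instance:
  assumes "\<omega> \<in> instances m" "2 * m + 1 \<le> n"
  shows "DISJ (alice n \<omega>) (bob n \<omega>) \<longleftrightarrow> \<not> fst \<omega>"
proof -
  obtain b i Z X Y where \<omega>: "\<omega> = (b, (i, Z), X, Y)" by (metis prod.collapse)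
  have "i < n" "X \<subseteq> {..<2 * m + 1} - Z" "Y \<subseteq> insert i Z" "(i \<in> X) = b" "(i \<in> Y) = b"
    using assms by (auto simp: \<omega> instances_def slice_def splits_def)
  then show ?thesis by (auto simp: \<omega> alice_def bob_def DISJ_encode)
qed

lemma finite_instances: "finite (instances m)"
proof -
  have "finite (slice b UNIV (insert i Z) i)" if "(i, Z) \<in> splits {..<2 * m + 1} m" for b i Z
    using that by (intro finite_slice finite_subset[of "insert i Z" "{..<2 * m + 1}"]) (auto simp: splits_def)
  then show ?thesis
    unfolding instances_def by (intro finite_SigmaI) (auto intro: finite_splits)
qed

lemma card_instances_rect:
  "card {\<omega>\<in>instances m. fst \<omega> = b \<and> alice n \<omega> \<in> A \<and> bob n \<omega> \<in> B}
    = (\<Sum>(i, Z)\<in>splits {..<2 * m + 1} m. card (slice b {X. encode n X \<in> A} ({..<2 * m + 1} - Z) i)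
        * card (slice b {Y. encode n Y \<in> B} (insert i Z) i))"
proof -
  let ?S = "SIGMA (i, Z):splits {..<2 * m + 1} m. slice b {X. encode n X \<in> A} ({..<2 * m + 1} - Z) i
      \<times> slice b {Y. encode n Y \<in> B} (insert i Z) i"
  have "{\<omega>\<in>instances m. fst \<omega> = b \<and> alice n \<omega> \<in> A \<and> bob n \<omega> \<in> B} = Pair b ` ?S"
    by (auto simp: instances_def alice_def bob_def slice_def image_iff)
  then have "card {\<omega>\<in>instances m. fst \<omega> = b \<and> alice n \<omega> \<in> A \<and> bob n \<omega> \<in> B} = card ?S"
    by (simp add: card_image inj_on_def)
  also have "\<dots> = (\<Sum>T\<in>splits {..<2 * m + 1} m. card (case T of (i, Z) \<Rightarrow>
      slice b {X. encode n X \<in> A} ({..<2 * m + 1} - Z) i \<times> slice b {Y. encode n Y \<in> B} (insert i Z) i))"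
  proof (rule card_SigmaI)
    show "\<forall>T\<in>splits {..<2 * m + 1} m. finite (case T of (i, Z) \<Rightarrow>
      slice b {X. encode n X \<in> A} ({..<2 * m + 1} - Z) i \<times> slice b {Y. encode n Y \<in> B} (insert i Z) i)"
      using finite_subset by (fastforce simp: splits_def)
  qed (simp add: finite_splits)
  finally show ?thesis by (simp add: case_prod_unfold card_cartesian_product)
qed

lemma card_instances_label:
  "card {\<omega>\<in>instances m. fst \<omega> = b} = card (splits {..<2 * m + 1} m) * 2 ^ (2 * m)"
proof -
  have "card (slice b UNIV ({..<2 * m + 1} - Z) i) * card (slice b UNIV (insert i Z) i) = 2 ^ (2 * m)"
    if "(i, Z) \<in> splits {..<2 * m + 1} m" for i Z
  proof -
    have Z: "i < 2 * m + 1" "Z \<subseteq> {..<2 * m + 1}" "i \<notin> Z" "card Z = m" "finite Z"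
      using that finite_subset by (auto simp: splits_def)
    have "card (slice b UNIV ({..<2 * m + 1} - Z) i) = 2 ^ m"
      using Z by (subst card_slice_UNIV) (auto simp: card_Diff_subset)
    moreover have "card (slice b UNIV (insert i Z) i) = 2 ^ m"
      using Z by (subst card_slice_UNIV) auto
    ultimately show ?thesis by (simp only: mult_2 power_add)
  qed
  then show ?thesis
    using card_instances_rect[of m b 0 UNIV UNIV] by (simp add: case_prod_unfold)
qed

lemma card_instances: "card (instances m) = 2 * (card (splits {..<2 * m + 1} m) * 2 ^ (2 * m))"
proof -
  have "instances m = {\<omega>\<in>instances m. fst \<omega> = True} \<union> {\<omega>\<in>instances m. fst \<omega> = False}"
    by auto
  then have "card (instances m) = card {\<omega>\<in>instances m. fst \<omega> = True} + card {\<omega>\<in>instances m. fst \<omega> = False}"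
    using finite_instances by (metis (no_types, lifting) card_Un_disjoint disjoint_iff finite_Un mem_Collect_eq)
  then show ?thesis by (simp only: card_instances_label)
qed

lemma corrupted_instances:
  "corrupted_instance (instances m) (alice n) (bob n) (\<lambda>\<omega>. \<not> fst \<omega>) (35/36) (err (m + 1))"
proof
  show "finite (instances m)" by (rule finite_instances)
  have "(2 * m, {..<m}) \<in> splits {..<2 * m + 1} m" by (auto simp: splits_def)
  then have "card (splits {..<2 * m + 1} m) \<noteq> 0"
    using finite_splits[of "{..<2 * m + 1}" m] by auto
  then show "instances m \<noteq> {}" using card_instances[of m] by auto
  show "2 * card {\<omega>\<in>instances m. \<not> fst \<omega>} = card (instances m)"
    using card_instances_label[of m False] card_instances[of m] by simp
  fix A B
  let ?R = "\<lambda>b. {\<omega>\<in>instances m. fst \<omega> = b \<and> alice n \<omega> \<in> A \<and> bob n \<omega> \<in> B}"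
  have "{\<omega>\<in>instances m. alice n \<omega> \<in> A \<and> bob n \<omega> \<in> B} = ?R True \<union> ?R False" by auto
  then have c: "card {\<omega>\<in>instances m. alice n \<omega> \<in> A \<and> bob n \<omega> \<in> B} = card (?R True) + card (?R False)"
    using finite_instances by (simp add: card_Un_disjoint disjoint_iff)
  \<comment> \<open>For D disjoint and I intersecting instances, D \<le> 35 I + error; adding 35 D
    yields the factor 35/36.\<close>
  have "real (card (?R False)) \<le> 35 * card (?R True) + 9 * (err (m + 1) * card (instances m) / 2)"
    unfolding card_instances_rect card_instances
    using disjointness_corruption[of "{..<2 * m + 1}" m "{X. encode n X \<in> A}" "{X. encode n X \<in> B}"]
    by (simp add: case_prod_unfold mult_ac)
  moreover have "0 \<le> err (m + 1) * card (instances m)" by (simp add: err_def)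
  ultimately show "real (card {\<omega>\<in>instances m. \<not> fst \<omega> \<and> alice n \<omega> \<in> A \<and> bob n \<omega> \<in> B})
      \<le> 35/36 * card {\<omega>\<in>instances m. alice n \<omega> \<in> A \<and> bob n \<omega> \<in> B} + err (m + 1) * card (instances m)"
    unfolding c by (simp add: field_simps)
qed (auto simp: err_def)

section \<open>Numerical estimates and the choice of constants\<close>

lemma err_le:
  assumes "n \<le> 2 * w"
  shows "err w \<le> 2 powr (- real n / 256)"
proof -
  \<comment> \<open>Base 1 / sqrt 2 turns the exponent w / 64 into w / 128 over base 2, and n \<le>
    2 w gives n / 256.\<close>
  have "sqrt (1/2) \<ge> (16/27 :: real)"
    by (rule real_le_rsqrt) (simp add: power2_eq_square)
  moreover have "(2::real) powr (-1/2) = sqrt (1/2)"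
    by (simp add: powr_minus_divide powr_half_sqrt real_sqrt_divide)
  ultimately have "(16/27 :: real) \<le> 2 powr (-1/2)" by simp
  then have "err w \<le> (2 powr (-1/2)) powr (w / 64)"
    unfolding err_def by (intro powr_mono2) auto
  also have "\<dots> = 2 powr (- real w / 128)" by (simp add: powr_powr)
  also have "\<dots> \<le> 2 powr (- real n / 256)"
    using assms by (intro powr_mono) auto
  finally show ?thesis .
qed

text \<open>The gap between the base reached, 143/144 = 286/288, and the base claimed must absorb
  the error. The crude 1 / 2 ^ k suffices, since the error decays exponentially in \<open>n\<close>
  and \<open>k\<close> is at most n / 4096.\<close>

lemma power_diff_ge:
  assumes "k \<ge> 1"
  shows "(287/288 :: real) ^ k - (143/144) ^ k \<ge> 1 / (512 * 2 ^ k)"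
proof -
  obtain j where k: "k = Suc j" using assms by (cases k) auto
  have "(143/144 :: real) ^ j \<le> (287/288) ^ j" by (intro power_mono) auto
  then have "(287/288 :: real) ^ k - (143/144) ^ k \<ge> (287/288) ^ j / 288"
    by (simp add: k)
  moreover have "(1/2 :: real) ^ j \<le> (287/288) ^ j" by (intro power_mono) auto
  moreover have "(1/2 :: real) ^ j \<ge> 0" by simp
  ultimately have "(287/288 :: real) ^ k - (143/144) ^ k \<ge> (1/2) ^ j / 1024"
    by linarith
  then show ?thesis by (simp add: k power_one_over)
qed

lemma error_term_le:
  fixes n :: nat
  assumes "k \<ge> 1" "real k \<le> n / 4096" "real c \<le> n / 4096" "n \<le> 2 * w"
  shows "2 ^ c * (k * err w) \<le> (287/288) ^ k - (143/144) ^ k"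
proof -
  define t where "t = real n / 4096"
  have t: "real k \<le> t" "real c \<le> t" "1 \<le> t" using assms by (auto simp: t_def)
  have k: "(2::real) ^ k \<le> 2 powr t" and "(2::real) ^ c \<le> 2 powr t"
    using t by (simp_all add: powr_mono flip: powr_realpow)
  moreover have "real k \<le> 2 powr t"
    using k of_nat_less_two_power[of k, where 'a = real] by linarith
  moreover have "err w \<le> 2 powr (- 16 * t)"
    using err_le[OF assms(4)] by (simp add: t_def)
  ultimately have "2 ^ c * (k * err w) \<le> 2 powr t * (2 powr t * 2 powr (- 16 * t))"
    by (intro mult_mono) (auto simp: err_def)
  \<comment> \<open>The exponent is -14 t, and 1 \<le> k \<le> t gives 13 t \<ge> 9; 2 ^ 9 is the
    512 of \<open>power_diff_ge\<close>.\<close>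
  also have "\<dots> \<le> 2 powr (- t - 9)"
    using t by (simp flip: powr_add)
  also have "\<dots> = 1 / (512 * 2 powr t)"
    by (simp add: powr_diff powr_minus field_simps)
  also have "\<dots> \<le> 1 / (512 * 2 ^ k)"
    using k by (intro divide_left_mono) auto
  also have "\<dots> \<le> (287/288) ^ k - (143/144) ^ k"
    by (rule power_diff_ge) fact
  finally show ?thesis .
qed

theorem mainTheorem12:
  shows "\<exists>\<epsilon>::real. \<epsilon> > 0 \<and> (\<exists>\<gamma>::real. \<gamma> > 0 \<and>
    (\<forall>(n::nat) (k::nat). real k \<le> \<epsilon> * real n \<longrightarrow>
      (\<forall>P :: (bool list list, bool list list, bool list) protocol pmf.
         rand_cost_le P (\<epsilon> * real n) \<longrightarrow>
         (\<exists>xs ys. length xs = k \<and> length ys = k \<and>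
            (\<forall>x \<in> set xs. length x = n) \<and> (\<forall>y \<in> set ys. length y = n) \<and>
            success_prob P xs ys (map2 DISJ xs ys) \<le> 2 powr (- \<gamma> * real k)))))"
proof (rule exI[of _ "1/4096"], rule conjI, simp, rule exI[of _ "log 2 (288/287)"], intro conjI allI impI)
  fix n k :: nat and P :: "(bool list list, bool list list, bool list) protocol pmf"
  assume kn: "real k \<le> 1/4096 * real n" and P: "rand_cost_le P (1/4096 * real n)"
  \<comment> \<open>\<gamma> = log 2 (288/287) turns the claim into (287/288) ^ k; \<epsilon> =
    1/4096 is a sixteenth of the rate 1/256 in \<open>err_le\<close>.\<close>
  have "2 powr (- log 2 (288/287)) = (287/288::real)"
    by (simp add: powr_minus)
  then have \<gamma>: "2 powr (- log 2 (288/287) * real k) = (287/288) ^ k"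
    by (metis powr_powr powr_realpow divide_pos_pos zero_less_numeral)
  show "\<exists>xs ys. length xs = k \<and> length ys = k \<and>
      (\<forall>x \<in> set xs. length x = n) \<and> (\<forall>y \<in> set ys. length y = n) \<and>
      success_prob P xs ys (map2 DISJ xs ys) \<le> 2 powr (- log 2 (288/287) * real k)"
  proof (cases "k = 0")
    case True
    then show ?thesis by (intro exI[of _ "[]"]) (simp add: success_prob_def)
  next
    case False
    \<comment> \<open>As k \<ge> 1 forces n > 0, 2 m + 1 is the largest odd number up to
      \<open>n\<close>; at most one coordinate is padding.\<close>
    define m where "m = (n - 1) div 2"
    define c where "c = nat \<lfloor>real n / 4096\<rfloor>"
    have c: "real c \<le> n / 4096" unfolding c_def by (rule of_nat_floor) simp
    have m: "2 * m + 1 \<le> n" "n \<le> 2 * (m + 1)" using False kn by (auto simp: m_def)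
    interpret corrupted_instance "instances m" "alice n" "bob n" "\<lambda>\<omega>. \<not> fst \<omega>" "35/36" "err (m + 1)"
      by (rule corrupted_instances)
    have "cost p \<le> c" if "p \<in> set_pmf P" for p
      using P that by (auto simp: rand_cost_le_def c_def le_nat_floor)
    then obtain ws where ws: "ws \<in> tuples k" and le:
      "success_prob P (map (alice n) ws) (map (bob n) ws) (map (\<lambda>\<omega>. \<not> fst \<omega>) ws)
        \<le> sqrt ((1 + 35/36) / 2) ^ k + 2 ^ c * (k * err (m + 1))"
      using randomized_hard_input by blast
    \<comment> \<open>The radicand is 71/72 = 1 - 2/144, and (143/144)^2 exceeds it by
      1/144^2.\<close>
    have "sqrt ((1 + 35/36) / 2) \<le> (143/144 :: real)"
      by (rule real_le_lsqrt) (auto simp: power2_eq_square)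
    then have "sqrt ((1 + 35/36) / 2) ^ k \<le> (143/144 :: real) ^ k"
      by (intro power_mono) auto
    moreover have "2 ^ c * (k * err (m + 1)) \<le> (287/288) ^ k - (143/144) ^ k"
      using False kn m(2) c by (intro error_term_le[where n = n]) auto
    moreover have "map2 DISJ (map (alice n) ws) (map (bob n) ws) = map (\<lambda>\<omega>. \<not> fst \<omega>) ws"
      using ws DISJ_instance[OF _ m(1)] by (auto simp: tuples_def map2_map_map)
    moreover have "length (alice n \<omega>) = n" "length (bob n \<omega>) = n" for \<omega>
      by (auto simp: alice_def bob_def encode_def split: prod.split)
    ultimately show ?thesis
      using le ws \<gamma> by (intro exI[of _ "map (alice n) ws"] exI[of _ "map (bob n) ws"])
        (auto simp: tuples_def)
  qed
qed auto

end
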